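(* Let $\mathcal{A}$ be a Banach algebra such that $\mathrm{rad}(\mathcal{A})=\mathrm{rann}(\mathcal{A})$ and the quotient algebra $\mathcal{A}/\mathrm{rad}(\mathcal{A})$ is commutative. Let $d$ be a derivation of $\mathcal{A}$ (not assumed bounded). Then $d(\mathcal{A})\subseteq \mathrm{rad}(\mathcal{A})$.
   Context: $\mathrm{rad}(\mathcal{A})$ is the Jacobson radical of $\mathcal{A}$, and $\mathrm{rann}(\mathcal{A})=\{c\in\mathcal{A}: ac=0 \text{ for all } a\in\mathcal{A}\}$ is the right annihilator of $\mathcal{A}$. A derivation of $\mathcal{A}$ is a linear map $d:\mathcal{A}\to\mathcal{A}$ with $d(ab)=d(a)b+ad(b)$ for all $a,b\in\mathcal{A}$. *)

theory Defs
  imports "HOL-Analysis.Analysis"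
begin

definition complex_banach_algebra :: "(complex \<Rightarrow> 'a::{real_normed_algebra,banach} \<Rightarrow> 'a) \<Rightarrow> bool" where
  "complex_banach_algebra sm \<longleftrightarrow>
     (\<forall>c x y. sm c (x + y) = sm c x + sm c y) \<and>
     (\<forall>c e x. sm (c + e) x = sm c x + sm e x) \<and>
     (\<forall>c e x. sm c (sm e x) = sm (c * e) x) \<and>
     (\<forall>x. sm 1 x = x) \<and>
     (\<forall>r x. sm (complex_of_real r) x = scaleR r x) \<and>
     (\<forall>c x. norm (sm c x) = cmod c * norm x) \<and>
     (\<forall>c x y. sm c (x * y) = sm c x * y \<and> sm c (x * y) = x * sm c y)"

definition left_ideal :: "(complex \<Rightarrow> 'a::{real_normed_algebra,banach} \<Rightarrow> 'a) \<Rightarrow> 'a set \<Rightarrow> bool" where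
  "left_ideal sm L \<longleftrightarrow>
     0 \<in> L \<and> (\<forall>x\<in>L. \<forall>y\<in>L. x + y \<in> L) \<and> (\<forall>c. \<forall>x\<in>L. sm c x \<in> L) \<and>
     (\<forall>a. \<forall>x\<in>L. a * x \<in> L)"

definition modular_left_ideal :: "(complex \<Rightarrow> 'a::{real_normed_algebra,banach} \<Rightarrow> 'a) \<Rightarrow> 'a set \<Rightarrow> bool" where
  "modular_left_ideal sm L \<longleftrightarrow> left_ideal sm L \<and> (\<exists>u. \<forall>a. a - a * u \<in> L)"

definition maximal_modular_left_ideal :: "(complex \<Rightarrow> 'a::{real_normed_algebra,banach} \<Rightarrow> 'a) \<Rightarrow> 'a set \<Rightarrow> bool" where
  "maximal_modular_left_ideal sm L \<longleftrightarrow>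
     modular_left_ideal sm L \<and> L \<noteq> UNIV \<and>
     (\<forall>J. left_ideal sm J \<and> L \<subseteq> J \<and> J \<noteq> UNIV \<longrightarrow> J = L)"

text \<open>Jacobson radical: intersection of all maximal modular left ideals
(the whole algebra if there are none).\<close>

definition jacobson_radical :: "(complex \<Rightarrow> 'a::{real_normed_algebra,banach} \<Rightarrow> 'a) \<Rightarrow> 'a set" where
  "jacobson_radical sm = \<Inter> {L. maximal_modular_left_ideal sm L}"

definition right_annihilator :: "'a::{real_normed_algebra,banach} set" where
  "right_annihilator = {c. \<forall>a. a * c = 0}"

definition derivation :: "(complex \<Rightarrow> 'a::{real_normed_algebra,banach} \<Rightarrow> 'a) \<Rightarrow> ('a \<Rightarrow> 'a) \<Rightarrow> bool" where
  "derivation sm d \<longleftrightarrow>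
     (\<forall>x y. d (x + y) = d x + d y) \<and> (\<forall>c x. d (sm c x) = sm c (d x)) \<and>
     (\<forall>a b. d (a * b) = d a * b + a * d b)"

end

theory Submission
  imports Defs "HOL-Computational_Algebra.Formal_Power_Series"
begin

text \<open>
  Gelfand-Mazur identifies the radical \<open>J\<close> with the common kernel of the characters \<open>\<phi>\<close>, and
  \<open>A J = 0\<close> forces \<open>d J \<subseteq> J\<close>; so this is Johnson's theorem that the semisimple commutative algebra
  \<open>A / J\<close> has no nonzero derivation. By a gliding hump, \<open>\<phi> \<circ> d\<close> is continuous for all but finitely
  many \<open>\<phi>\<close>. An exceptional \<open>\<phi>\<close> that does not vanish on the separating space of \<open>d\<close> would be isolated
  by an idempotent modulo \<open>J\<close>, which forces \<open>\<phi> \<circ> d = 0\<close>. Hence \<open>d\<close> is closed, and so bounded by some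
  \<open>M\<close>, modulo \<open>J\<close>. If \<open>\<phi> x = 0\<close>, then \<open>n! \<bar>\<phi> (d x)\<bar>\<^sup>n = \<bar>\<phi> (d\<^sup>n (x\<^sup>n))\<bar> \<le> M\<^sup>n \<parallel>x\<parallel>\<^sup>n\<close> for all \<open>n\<close>, so
  \<open>\<phi> (d x) = 0\<close>.
\<close>

subsection \<open>Consequences of completeness\<close>

lemma closed_cover_interior_nonempty:
  fixes C :: "nat \<Rightarrow> 'a::banach set"
  assumes "\<And>n. closed (C n)" and "(\<Union>n. C n) = UNIV"
  obtains n where "interior (C n) \<noteq> {}"
proof -
  have "\<exists>n. interior (C n) \<noteq> {}"
  proof (rule ccontr)
    assume "\<not> ?thesis"
    then have "(euclidean :: 'a topology) interior_of \<Union>(range C) = {}"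
      using assms(1) by (intro Baire_category_alt) (auto simp: completely_metrizable_space_euclidean)
    then show False using assms(2) by simp
  qed
  then show ?thesis using that by blast
qed

text \<open>The kernels are closed proper subspaces, so they have empty interior and by Baire cannot
  cover the space. This later yields one element at which countably many characters are nonzero and
  pairwise distinct.\<close>

lemma common_nonvanishing_vector:
  fixes f :: "nat \<Rightarrow> 'a::banach \<Rightarrow> 'b::real_normed_vector"
  assumes lin: "\<And>k. bounded_linear (f k)" and nz: "\<And>k. \<exists>v. f k v \<noteq> 0"
  obtains p where "\<And>k. f k p \<noteq> 0"
proof (rule ccontr)
  assume "\<not> thesis"
  then have cover: "(\<Union>k. {x. f k x = 0}) = UNIV"
    using that by blast
  have "closed {x. f k x = 0}" for k
    by (intro closed_Collect_eq continuous_intros linear_continuous_on lin)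
  then obtain k x where x: "x \<in> interior {x. f k x = 0}"
    using closed_cover_interior_nonempty[of "\<lambda>k. {x. f k x = 0}"] cover by blast
  then obtain r where r: "r > 0" "ball x r \<subseteq> {x. f k x = 0}"
    using mem_interior by blast
  interpret bounded_linear "f k" by (rule lin)
  obtain v where v: "f k v \<noteq> 0" using nz by blast
  then have "v \<noteq> 0" using zero by auto
  define t where "t = r / (2 * norm v)"
  have t: "t > 0" using r \<open>v \<noteq> 0\<close> by (simp add: t_def)
  have "x + t *\<^sub>R v \<in> ball x r"
    using r t \<open>v \<noteq> 0\<close> by (simp add: dist_norm t_def)
  moreover have "x \<in> ball x r" using r by simp
  ultimately have "f k (x + t *\<^sub>R v) = 0" "f k x = 0" using r(2) by blast+
  then show False using v t by (simp add: add scaleR)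
qed

text \<open>A closed graph theorem for multivalued maps, which lets a quotient of the target be handled
  without being formed.\<close>

lemma closed_linear_relation_bounded:
  fixes G :: "('a::banach \<times> 'b::banach) set"
  assumes sub: "subspace G" and cl: "closed G" and dom: "\<And>x. \<exists>y. (x, y) \<in> G"
  obtains M where "M \<ge> 0" "\<And>x. \<exists>y. (x, y) \<in> G \<and> norm y \<le> M * norm x"
proof -
  \<comment> \<open>By Baire the closure of some \<open>E n\<close> contains a ball; successive
    approximation then removes the closure, as in the open mapping theorem.\<close>
  define E where "E = (\<lambda>n::nat. {x. \<exists>y. (x, y) \<in> G \<and> norm y \<le> real n})"
  have "(\<Union>n. closure (E n)) = UNIV"
  proof -
    have "x \<in> (\<Union>n. closure (E n))" for x
    proof -
      obtain y where y: "(x, y) \<in> G" using dom by blast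
      obtain n where "norm y \<le> real n" using real_arch_simple by blast
      then have "x \<in> E n" using y by (auto simp: E_def)
      then show ?thesis using closure_subset by blast
    qed
    then show ?thesis by blast
  qed
  then obtain n where "interior (closure (E n)) \<noteq> {}"
    using closed_cover_interior_nonempty[of "\<lambda>n. closure (E n)"] by (metis closed_closure)
  then obtain x0 r where r: "r > 0" "ball x0 r \<subseteq> closure (E n)"
    by (meson all_not_in_conv mem_interior)
  \<comment> \<open>Subtracting an approximant of \<open>x0\<close> from one of
    \<open>x0 + z\<close> moves the ball to the origin and doubles the bound.\<close>
  have near: "\<exists>a b. (a, b) \<in> G \<and> norm b \<le> 2 * real n \<and> norm (z - a) < e"
    if z: "norm z < r" and e: "e > 0" for z e
  proof -
    have "x0 + z \<in> closure (E n)" "x0 \<in> closure (E n)"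
      using r z by (auto simp: subset_iff dist_norm)
    then obtain p q where p: "p \<in> E n" "dist p (x0 + z) < e/2" and q: "q \<in> E n" "dist q x0 < e/2"
      using e by (meson closure_approachable half_gt_zero)
    then obtain b c where b: "(p, b) \<in> G" "norm b \<le> n" and c: "(q, c) \<in> G" "norm c \<le> n"
      by (auto simp: E_def)
    have "(p - q, b - c) \<in> G"
      using subspace_diff[OF sub b(1) c(1)] by simp
    moreover have "norm (b - c) \<le> 2 * real n"
      using norm_triangle_ineq4[of b c] b c by linarith
    moreover have "norm (z - (p - q)) < e"
    proof -
      have "z - (p - q) = (q - x0) - (p - (x0 + z))" by simp
      then have "norm (z - (p - q)) \<le> norm (q - x0) + norm (p - (x0 + z))"
        by (metis norm_triangle_ineq4)
      then show ?thesis using p q by (simp add: dist_norm)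
    qed
    ultimately show ?thesis by blast
  qed
  define c where "c = 4 * real n / r"
  have c0: "c \<ge> 0" using r by (simp add: c_def)
  have "\<exists>a b. (a, b) \<in> G \<and> norm b \<le> c * norm x \<and> norm (x - a) \<le> norm x / 2" for x
  proof (cases "x = 0")
    case True
    then show ?thesis
      using subspace_0[OF sub] by (intro exI[of _ 0]) (auto simp: zero_prod_def)
  next
    case False
    \<comment> \<open>Dividing by \<open>t\<close> brings \<open>x\<close> to norm
      \<open>r/2\<close>, inside the ball. Scaling back turns the error \<open>r/4\<close> into
      \<open>norm x / 2\<close> and the bound \<open>2 * n\<close> into
      \<open>c * norm x\<close>.\<close>
    define t where "t = 2 * norm x / r"
    have t: "t > 0" using False r by (simp add: t_def)
    have "norm ((1/t) *\<^sub>R x) < r" using False r by (simp add: t_def)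
    then obtain a b where ab: "(a, b) \<in> G" "norm b \<le> 2 * real n" "norm ((1/t) *\<^sub>R x - a) < r/4"
      using near[of "(1/t) *\<^sub>R x" "r/4"] r by auto
    have "(t *\<^sub>R a, t *\<^sub>R b) \<in> G"
      using subspace_scale[OF sub ab(1), of t] by simp
    moreover have "norm (t *\<^sub>R b) \<le> c * norm x"
      using mult_left_mono[OF ab(2), of t] t r by (simp add: t_def c_def mult_ac)
    moreover have "norm (x - t *\<^sub>R a) \<le> norm x / 2"
    proof -
      have "x - t *\<^sub>R a = t *\<^sub>R ((1/t) *\<^sub>R x - a)"
        using t by (simp add: scaleR_diff_right)
      then have "norm (x - t *\<^sub>R a) = t * norm ((1/t) *\<^sub>R x - a)" using t by simp
      also have "\<dots> \<le> t * (r/4)" using ab t by (intro mult_left_mono) auto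
      finally show ?thesis using r by (simp add: t_def)
    qed
    ultimately show ?thesis by blast
  qed
  then obtain f h where fh: "\<And>x. (f x, h x) \<in> G" "\<And>x. norm (h x) \<le> c * norm x"
      "\<And>x. norm (x - f x) \<le> norm x / 2"
    by metis
  have "\<exists>y. (x, y) \<in> G \<and> norm y \<le> 2 * c * norm x" for x
  proof -
    \<comment> \<open>\<open>X k\<close> is what remains of \<open>x\<close> after \<open>k\<close>
      corrections. It is halved each time, so the second components \<open>h (X k)\<close> form an
      absolutely convergent series.\<close>
    define X where "X = rec_nat x (\<lambda>_ z. z - f z)"
    have X0: "X 0 = x" and XS: "X (Suc k) = X k - f (X k)" for k
      by (simp_all add: X_def)
    have nX: "norm (X k) \<le> norm x * (1/2)^k" for k
    proof (induction k)
      case (Suc k)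
      then show ?case using fh(3)[of "X k"] by (simp add: XS)
    qed (simp add: X0)
    have nh: "norm (h (X k)) \<le> c * norm x * (1/2)^k" for k
    proof -
      have "norm (h (X k)) \<le> c * norm (X k)" by (rule fh)
      also have "\<dots> \<le> c * (norm x * (1/2)^k)" by (intro mult_left_mono nX c0)
      finally show ?thesis by simp
    qed
    have geo: "(\<lambda>k. c * norm x * (1/2)^k) sums (c * norm x * 2)"
      using sums_mult[OF geometric_sums[of "1/2::real"], of "c * norm x"] by simp
    have sm: "summable (\<lambda>k. norm (h (X k)))"
      by (rule summable_comparison_test'[OF sums_summable[OF geo], of 0]) (simp add: nh)
    have pg: "(x - X m, \<Sum>k<m. h (X k)) \<in> G" for m
    proof (induction m)
      case 0
      then show ?case using subspace_0[OF sub] by (simp add: X0 zero_prod_def)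
    next
      case (Suc m)
      then show ?case using subspace_add[OF sub Suc fh(1)[of "X m"]] by (simp add: XS algebra_simps)
    qed
    have "X \<longlonglongrightarrow> 0"
    proof (rule Lim_null_comparison)
      show "\<forall>\<^sub>F k in sequentially. norm (X k) \<le> norm x * (1/2)^k" using nX by simp
      show "(\<lambda>k. norm x * (1/2)^k) \<longlonglongrightarrow> 0"
        by (intro tendsto_mult_right_zero LIMSEQ_realpow_zero) auto
    qed
    then have "(\<lambda>m. (x - X m, \<Sum>k<m. h (X k))) \<longlonglongrightarrow> (x - 0, \<Sum>k. h (X k))"
      by (intro tendsto_Pair tendsto_diff tendsto_const summable_LIMSEQ summable_norm_cancel[OF sm])
    then have "(x, \<Sum>k. h (X k)) \<in> G"
      using closed_sequentially[OF cl, of "\<lambda>m. (x - X m, \<Sum>k<m. h (X k))"] pg by simp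
    moreover have "norm (\<Sum>k. h (X k)) \<le> 2 * c * norm x"
    proof -
      have "norm (\<Sum>k. h (X k)) \<le> (\<Sum>k. norm (h (X k)))" by (rule summable_norm[OF sm])
      also have "\<dots> \<le> c * norm x * 2"
        using suminf_le[OF nh sm sums_summable[OF geo]] sums_unique[OF geo] by simp
      finally show ?thesis by simp
    qed
    ultimately show ?thesis by blast
  qed
  then show ?thesis using that[of "2 * c"] c0 by simp
qed

lemma unbounded_small_vector:
  fixes g :: "'a::real_normed_vector \<Rightarrow> 'b::real_normed_vector"
  assumes "linear g" and "\<nexists>C. \<forall>y. norm (g y) \<le> C * norm y" and "e > 0"
  obtains y where "norm y \<le> e" "norm (g y) \<ge> K"
proof -
  obtain y where y: "norm (g y) > (\<bar>K\<bar> / e) * norm y"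
    using assms(2) by (meson not_le)
  then have "y \<noteq> 0" using linear_0[OF assms(1)] by auto
  define t where "t = e / norm y"
  have t: "t > 0" using \<open>y \<noteq> 0\<close> assms by (simp add: t_def)
  have "norm (t *\<^sub>R y) \<le> e" using \<open>y \<noteq> 0\<close> assms by (simp add: t_def)
  moreover have "norm (g (t *\<^sub>R y)) \<ge> K"
  proof -
    have "t * norm (g y) \<ge> t * ((\<bar>K\<bar> / e) * norm y)" using t y by (intro mult_left_mono) auto
    also have "t * ((\<bar>K\<bar> / e) * norm y) = \<bar>K\<bar>" using \<open>y \<noteq> 0\<close> assms by (simp add: t_def)
    finally show ?thesis using t by (simp add: linear_scale[OF assms(1)])
  qed
  ultimately show ?thesis using that by blast
qed

text \<open>The gliding hump behind Johnson's theorem. A vector \<open>\<Sum>m. R 0 (\<dots> (R (m-1) (y m)))\<close> with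
  rapidly decreasing \<open>y m\<close> meets \<open>g n\<close> only through its first \<open>n + 1\<close> terms, although \<open>g n\<close> is
  not continuous, because the tail lies in the range of \<open>R 0 \<circ> \<dots> \<circ> R n\<close>.\<close>

lemma gliding_hump:
  fixes g :: "nat \<Rightarrow> 'a::banach \<Rightarrow> 'b::real_normed_vector" and R :: "nat \<Rightarrow> 'a \<Rightarrow> 'a"
    and W :: "nat \<Rightarrow> 'a \<Rightarrow> 'a"
  assumes lg: "\<And>n. linear (g n)" and bd: "\<And>x. \<exists>B. \<forall>n. norm (g n x) \<le> B"
    and lR: "\<And>n. bounded_linear (R n)" and nR: "\<And>n x. norm (R n x) \<le> norm x"
    and W0: "\<And>x. W 0 x = x" and WS: "\<And>n x. W (Suc n) x = W n (R n x)"
    and vanish: "\<And>n x. g n (W (Suc n) x) = 0"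
  obtains n C where "\<And>x. norm (g n (W n x)) \<le> C * norm x"
proof (rule ccontr)
  assume "\<not> thesis"
  then have unb: "\<nexists>C. \<forall>x. norm (g n (W n x)) \<le> C * norm x" for n
    using that by blast
  have lW: "bounded_linear (W n)" for n
  proof (induction n)
    case 0
    have "W 0 = (\<lambda>x. x)" using W0 by auto
    then show ?case by (simp add: bounded_linear_ident)
  next
    case (Suc n)
    have "W (Suc n) = (\<lambda>x. W n (R n x))" using WS by auto
    then show ?case using bounded_linear_compose[OF Suc lR] by simp
  qed
  \<comment> \<open>Here \<open>s\<close> is the sum of the earlier terms and \<open>y\<close> the
    next vector: \<open>y\<close> is small, yet its contribution to \<open>g n\<close> outweighs
    that of \<open>s\<close> by \<open>n\<close>.\<close>
  define P where "P = (\<lambda>n (s, y). norm y \<le> (1/2::real)^n \<and>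
      norm (g n (W n y)) \<ge> real n + norm (g n s))"
  have step: "\<exists>y. P n (s, y)" for n s
  proof -
    have "linear (\<lambda>y. g n (W n y))"
      using linear_compose[OF bounded_linear.linear[OF lW] lg] by (simp add: o_def)
    then obtain y where "norm y \<le> (1/2)^n" "norm (g n (W n y)) \<ge> real n + norm (g n s)"
      using unbounded_small_vector[OF _ unb, of n "(1/2)^n" "real n + norm (g n s)"] by auto
    then show ?thesis by (auto simp: P_def)
  qed
  obtain f where f: "\<And>n. P n (f n)" "\<And>n. fst (f (Suc n)) = fst (f n) + W n (snd (f n))"
      and f0: "fst (f 0) = 0"
  proof -
    have "\<exists>f. \<forall>n. (P n (f n) \<and> (n = 0 \<longrightarrow> fst (f n) = 0)) \<and> fst (f (Suc n)) = fst (f n) + W n (snd (f n))"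
    proof (rule dependent_nat_choice)
      show "\<exists>x. P 0 x \<and> (0 = (0::nat) \<longrightarrow> fst x = 0)" using step[of 0 0] by auto
      show "\<exists>y. (P (Suc n) y \<and> (Suc n = 0 \<longrightarrow> fst y = 0)) \<and> fst y = fst x + W n (snd x)" for x n
        using step[of "Suc n" "fst x + W n (snd x)"] by auto
    qed
    then show ?thesis using that by blast
  qed
  define y where "y = (\<lambda>n. snd (f n))"
  have s: "fst (f n) = (\<Sum>m<n. W m (y m))" for n
    by (induction n) (simp_all add: f0 f(2) y_def)
  have ny: "norm (y n) \<le> (1/2)^n" and gy: "norm (g n (W n (y n))) \<ge> real n + norm (g n (\<Sum>m<n. W m (y m)))" for n
    using f(1)[of n] s[of n] by (auto simp: P_def y_def split: prod.splits)
  \<comment> \<open>\<open>W (m + k)\<close> is \<open>W k\<close> applied after the nonexpansive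
    maps \<open>R k\<close>, ..., \<open>R (m + k - 1)\<close>, so each later term is
    \<open>W k\<close> of an equally small vector.\<close>
  have tail: "\<exists>V. (\<forall>m. norm (V m) \<le> (1/2)^m) \<and> (\<forall>m. W k (V m) = W (m + k) (y (m + k)))" for k
  proof -
    have "\<exists>v. norm v \<le> norm z \<and> W k v = W (m + k) z" for m z
    proof (induction m arbitrary: z)
      case (Suc m)
      from Suc[of "R (m + k) z"] nR[of "m + k" z] show ?case
        by (metis WS add_Suc order_trans)
    qed auto
    then have "\<forall>m. \<exists>v. norm v \<le> norm (y (m + k)) \<and> W k v = W (m + k) (y (m + k))"
      by blast
    then obtain V where V: "\<And>m. norm (V m) \<le> norm (y (m + k)) \<and> W k (V m) = W (m + k) (y (m + k))"
      by (auto dest!: choice)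
    have "norm (V m) \<le> (1/2)^m" for m
    proof -
      have "norm (V m) \<le> (1/2)^(m + k)" using V ny order_trans by blast
      also have "\<dots> \<le> (1/2)^m" by (rule power_decreasing) auto
      finally show ?thesis .
    qed
    then show ?thesis using V by blast
  qed
  have half: "summable (\<lambda>m. (1/2::real)^m)" by (rule summable_geometric) simp
  have tl: "summable (\<lambda>m. W (m + k) (y (m + k))) \<and> (\<exists>w. (\<Sum>m. W (m + k) (y (m + k))) = W k w)" for k
  proof -
    obtain V where V: "\<And>m. norm (V m) \<le> (1/2)^m" "\<And>m. W k (V m) = W (m + k) (y (m + k))"
      using tail by blast
    have "summable V"
      by (rule summable_comparison_test'[OF half, of 0]) (simp add: V)
    then have "(\<lambda>m. W k (V m)) sums W k (\<Sum>m. V m)"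
      by (intro bounded_linear.sums[OF lW] summable_sums)
    then show ?thesis by (auto simp: V(2) sums_iff)
  qed
  define x where "x = (\<Sum>m. W m (y m))"
  have sx: "summable (\<lambda>m. W m (y m))" using tl[of 0] by simp
  have "norm (g n x) \<ge> real n" for n
  proof -
    obtain w where w: "(\<Sum>m. W (m + Suc n) (y (m + Suc n))) = W (Suc n) w" using tl by blast
    have "x = W (Suc n) w + ((\<Sum>m<n. W m (y m)) + W n (y n))"
      unfolding x_def using suminf_split_initial_segment[OF sx, of "Suc n"] w by simp
    then have "g n x = g n (\<Sum>m<n. W m (y m)) + g n (W n (y n))"
      by (simp add: linear_add[OF lg] vanish)
    then show ?thesis
      using gy[of n] norm_diff_ineq[of "g n (W n (y n))" "g n (\<Sum>m<n. W m (y m))"]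
      by (simp add: add.commute)
  qed
  moreover obtain B where "\<And>n. norm (g n x) \<le> B" using bd by blast
  moreover obtain n where "real n > B" using reals_Archimedean2 by blast
  ultimately show False by (meson not_less order_trans)
qed

text \<open>Neumann series: \<open>b = - (a + a\<^sup>2 + ...)\<close>. In an algebra without unit
  this relation stands for \<open>1 - a\<close> and \<open>1 - b\<close> being mutually
  inverse.\<close>

lemma quasi_inverse_exists:
  fixes a :: "'a::{real_normed_algebra,banach}"
  assumes a: "norm a < 1"
  obtains b where "a + b = a * b" "a * b = b * a"
proof -
  \<comment> \<open>\<open>p n\<close> is the power of \<open>a\<close> with exponent
    \<open>n + 1\<close>.\<close>
  define p where "p = (\<lambda>n. ((*) a ^^ n) a)"
  have p0: "p 0 = a" and pS: "p (Suc n) = a * p n" for n by (simp_all add: p_def)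
  have comm: "p n * a = a * p n" for n
    by (induction n) (simp_all add: p0 pS mult.assoc)
  have np: "norm (p n) \<le> norm a ^ n" for n
  proof (induction n)
    case 0
    then show ?case using a by (simp add: p0)
  next
    case (Suc n)
    have "norm (p (Suc n)) \<le> norm a * norm (p n)" by (simp add: pS norm_mult_ineq)
    also have "\<dots> \<le> norm a * norm a ^ n" using Suc by (intro mult_left_mono) auto
    finally show ?case by simp
  qed
  have sp: "summable p"
    by (rule summable_comparison_test'[of "\<lambda>n. norm a ^ n" 0]) (use a np in \<open>auto intro: summable_geometric\<close>)
  define s where "s = suminf p"
  have left: "a * s = s - a"
  proof -
    have "a * s = (\<Sum>n. a * p n)"
      using bounded_linear.suminf[OF bounded_linear_mult_right sp] by (simp add: s_def)
    also have "\<dots> = s - p 0" using suminf_split_head[OF sp] by (simp add: pS s_def)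
    finally show ?thesis by (simp add: p0)
  qed
  have right: "s * a = a * s"
  proof -
    have "s * a = (\<Sum>n. p n * a)"
      using bounded_linear.suminf[OF bounded_linear_mult_left sp] by (simp add: s_def)
    also have "\<dots> = a * s"
      using bounded_linear.suminf[OF bounded_linear_mult_right sp] by (simp add: comm s_def)
    finally show ?thesis .
  qed
  show ?thesis by (rule that[of "- s"]) (simp_all add: left right)
qed

text \<open>The mean inequality \<open>sub\<close> with an error of order four prevents \<open>z \<mapsto> g z + \<epsilon> \<bar>z\<bar>\<^sup>2\<close> from having
  an interior maximum.\<close>

lemma approx_subharmonic_not_vanishing_at_infinity:
  fixes g :: "complex \<Rightarrow> real"
  assumes cont: "continuous_on UNIV g" and pos: "\<And>z. g z > 0"
    and sub: "\<And>z r. r > 0 \<Longrightarrow> 4 * g z \<le> (1 + (g z) ^ 4 * r ^ 4) *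
      (g (z + of_real r) + g (z + \<i> * of_real r) + g (z - of_real r) + g (z - \<i> * of_real r))"
    and decay: "(g \<longlongrightarrow> 0) at_infinity"
  shows False
proof -
  have "\<forall>\<^sub>F z in at_infinity. dist (g z) 0 < g 0 / 2"
    using decay pos[of 0] by (intro tendstoD) auto
  then obtain \<rho>' where \<rho>': "\<And>z. norm z \<ge> \<rho>' \<Longrightarrow> g z < g 0 / 2"
    unfolding eventually_at_infinity using pos by (auto simp: abs_of_pos)
  define \<rho> where "\<rho> = max 1 \<rho>'"
  have \<rho>: "\<rho> > 0" "\<And>z. norm z = \<rho> \<Longrightarrow> g z < g 0 / 2"
    using \<rho>' by (auto simp: \<rho>_def)
  \<comment> \<open>On the circle of radius \<open>\<rho>\<close> the added term is
    \<open>g 0 / 4\<close> while \<open>g\<close> is below \<open>g 0 / 2\<close>, so the maximum of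
    \<open>h\<close> is not attained there.\<close>
  define \<epsilon> where "\<epsilon> = g 0 / (4 * \<rho>\<^sup>2)"
  have \<epsilon>: "\<epsilon> > 0" using pos[of 0] \<rho> by (simp add: \<epsilon>_def)
  define h where "h = (\<lambda>z. g z + \<epsilon> * (norm z)\<^sup>2)"
  have "continuous_on (cball 0 \<rho>) h"
    unfolding h_def by (intro continuous_intros continuous_on_subset[OF cont]) auto
  then obtain z where z: "norm z \<le> \<rho>" and hz: "\<And>w. norm w \<le> \<rho> \<Longrightarrow> h w \<le> h z"
    using continuous_attains_sup[of "cball 0 \<rho>" h] \<rho> by auto
  show False
  proof (cases "norm z = \<rho>")
    case True
    have "h 0 \<le> h z" using hz \<rho> by simp
    then have "g 0 \<le> g z + g 0 / 4" using True \<rho> by (simp add: h_def \<epsilon>_def)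
    then show False using \<rho>(2)[OF True] pos[of 0] by linarith
  next
    case False
    define G where "G = g z"
    have G: "G > 0" using pos by (simp add: G_def)
    \<comment> \<open>The first bound keeps the four points in the disc; the second makes the error
      \<open>4 * G ^ 5 * r ^ 4\<close> smaller than the gain
      \<open>4 * \<epsilon> * r\<^sup>2\<close>.\<close>
    define r where "r = min (\<rho> - norm z) (sqrt (\<epsilon> / (2 * G ^ 5)))"
    have r: "r > 0" "norm z + r \<le> \<rho>"
      using False z \<epsilon> G by (auto simp: r_def)
    have r2: "G ^ 5 * r\<^sup>2 < \<epsilon>"
    proof -
      have "r\<^sup>2 \<le> (sqrt (\<epsilon> / (2 * G ^ 5)))\<^sup>2" using r by (intro power_mono) (auto simp: r_def)
      also have "\<dots> = \<epsilon> / (2 * G ^ 5)" using \<epsilon> G by simp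
      finally have "G ^ 5 * r\<^sup>2 \<le> \<epsilon> / 2" using G by (simp add: field_simps)
      then show ?thesis using \<epsilon> by linarith
    qed
    have step: "g (z + w) \<le> G + \<epsilon> * ((norm z)\<^sup>2 - (norm (z + w))\<^sup>2)" if "norm w = r" for w
    proof -
      have "norm (z + w) \<le> \<rho>" using norm_triangle_ineq[of z w] r that by linarith
      from hz[OF this] show ?thesis by (simp add: h_def G_def algebra_simps)
    qed
    let ?S = "g (z + of_real r) + g (z + \<i> * of_real r) + g (z - of_real r) + g (z - \<i> * of_real r)"
    have circle: "(norm (z + of_real r))\<^sup>2 + (norm (z + \<i> * of_real r))\<^sup>2 + (norm (z - of_real r))\<^sup>2
        + (norm (z - \<i> * of_real r))\<^sup>2 = 4 * (norm z)\<^sup>2 + 4 * r\<^sup>2"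
      unfolding cmod_power2 by (simp add: power2_eq_square algebra_simps)
    have "?S \<le> 4 * G + \<epsilon> * (4 * (norm z)\<^sup>2 - ((norm (z + of_real r))\<^sup>2 + (norm (z + \<i> * of_real r))\<^sup>2
        + (norm (z - of_real r))\<^sup>2 + (norm (z - \<i> * of_real r))\<^sup>2))"
      using step[of "of_real r"] step[of "\<i> * of_real r"] step[of "- of_real r"] step[of "- (\<i> * of_real r)"] r
      by (simp add: norm_mult algebra_simps)
    then have S: "?S \<le> 4 * G - 4 * \<epsilon> * r\<^sup>2" unfolding circle by (simp add: algebra_simps)
    have "4 * G \<le> (1 + G ^ 4 * r ^ 4) * ?S" using sub[OF r(1), of z] by (simp add: G_def)
    also have "\<dots> \<le> (1 + G ^ 4 * r ^ 4) * (4 * G - 4 * \<epsilon> * r\<^sup>2)"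
      using S G r by (intro mult_left_mono) (auto intro!: add_nonneg_nonneg)
    also have "\<dots> = 4 * G + 4 * r\<^sup>2 * (G ^ 5 * r\<^sup>2 - \<epsilon>) - 4 * G ^ 4 * r ^ 6 * \<epsilon>"
      by (simp add: algebra_simps power_numeral_reduce)
    also have "\<dots> < 4 * G"
    proof -
      have "4 * r\<^sup>2 * (G ^ 5 * r\<^sup>2 - \<epsilon>) < 0" using r r2 by (intro mult_pos_neg) auto
      moreover have "4 * G ^ 4 * r ^ 6 * \<epsilon> > 0" using r G \<epsilon> by simp
      ultimately show ?thesis by linarith
    qed
    finally show False by simp
  qed
qed

subsection \<open>The Gelfand-Mazur theorem modulo a maximal ideal\<close>

locale complex_banach_alg =
  fixes sm :: "complex \<Rightarrow> 'a::{real_normed_algebra,banach} \<Rightarrow> 'a"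
  assumes cba: "complex_banach_algebra sm"
begin

sublocale vs: vector_space sm
  by unfold_locales (use cba in \<open>simp_all add: complex_banach_algebra_def\<close>)

lemma sm_of_real: "sm (of_real r) x = r *\<^sub>R x"
  and norm_sm: "norm (sm c x) = norm c * norm x"
  and sm_mult_left: "sm c x * y = sm c (x * y)"
  and sm_mult_right: "x * sm c y = sm c (x * y)"
  using cba unfolding complex_banach_algebra_def by metis+

end

text \<open>The field A / L is treated through congruences modulo \<open>L\<close>, with
  \<open>u\<close> as its identity; \<open>comm\<close> makes \<open>L\<close> two-sided.\<close>

locale maximal_modular_ideal = complex_banach_alg sm
  for sm :: "complex \<Rightarrow> 'a::{real_normed_algebra,banach} \<Rightarrow> 'a" +
  fixes L :: "'a set" and u :: 'a
  assumes max: "maximal_modular_left_ideal sm L"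
    and comm: "a * b - b * a \<in> L"
    and modular: "a - a * u \<in> L"
begin

lemma L_zero: "0 \<in> L"
  and L_add: "x \<in> L \<Longrightarrow> y \<in> L \<Longrightarrow> x + y \<in> L"
  and L_sm: "x \<in> L \<Longrightarrow> sm c x \<in> L"
  and L_left: "x \<in> L \<Longrightarrow> a * x \<in> L"
  using max
  by (simp_all add: maximal_modular_left_ideal_def modular_left_ideal_def left_ideal_def)

lemma L_minus: "x \<in> L \<Longrightarrow> - x \<in> L"
  using L_sm[of x "-1"] by simp

lemma L_diff: "x \<in> L \<Longrightarrow> y \<in> L \<Longrightarrow> x - y \<in> L"
  using L_add[of x "- y"] L_minus by simp

lemma L_right: "x \<in> L \<Longrightarrow> x * a \<in> L"
  using L_add[OF comm[of x a] L_left[of x a]] by simp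

lemma L_proper: "L \<noteq> UNIV"
  using max by (simp add: maximal_modular_left_ideal_def)

lemma unit_notin: "u \<notin> L"
proof
  assume "u \<in> L"
  then have "a \<in> L" for a using L_add[OF modular[of a] L_left[of u a]] by simp
  then show False using L_proper by blast
qed

text \<open>The left ideal \<open>A x + L\<close> contains \<open>x\<close>, because
  \<open>x - u * x\<close> lies in \<open>L\<close>. By maximality it is everything, so it contains
  \<open>u\<close>.\<close>

lemma inverse_mod:
  assumes "x \<notin> L"
  obtains b where "b * x - u \<in> L"
proof -
  define I where "I = {b * x + l | b l. l \<in> L}"
  have "left_ideal sm I"
    unfolding left_ideal_def
  proof (intro conjI ballI allI)
    show "0 \<in> I" unfolding I_def using L_zero by (force intro: exI[of _ 0])
  next
    fix y z assume "y \<in> I" "z \<in> I"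
    then obtain b l c m where "y = b * x + l" "l \<in> L" "z = c * x + m" "m \<in> L" by (auto simp: I_def)
    then have "y + z = (b + c) * x + (l + m) \<and> l + m \<in> L" by (simp add: algebra_simps L_add)
    then show "y + z \<in> I" by (auto simp: I_def)
  next
    fix c y assume "y \<in> I"
    then obtain b l where "y = b * x + l" "l \<in> L" by (auto simp: I_def)
    then have "sm c y = sm c b * x + sm c l \<and> sm c l \<in> L"
      by (simp add: vs.scale_right_distrib sm_mult_left L_sm)
    then show "sm c y \<in> I" by (auto simp: I_def)
  next
    fix a y assume "y \<in> I"
    then obtain b l where "y = b * x + l" "l \<in> L" by (auto simp: I_def)
    then have "a * y = (a * b) * x + a * l \<and> a * l \<in> L" by (simp add: algebra_simps L_left)
    then show "a * y \<in> I" by (auto simp: I_def)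
  qed
  moreover have "L \<subseteq> I" unfolding I_def by (force intro: exI[of _ 0])
  moreover have "x \<in> I"
  proof -
    have "x - u * x = (x - x * u) + (x * u - u * x)" by simp
    then have "x - u * x \<in> L" using L_add[OF modular comm] by metis
    then have "\<exists>b l. x = b * x + l \<and> l \<in> L" by (intro exI[of _ u] exI[of _ "x - u * x"]) simp
    then show ?thesis by (auto simp: I_def)
  qed
  ultimately have "I = UNIV"
    using max assms unfolding maximal_modular_left_ideal_def by blast
  then have "u \<in> I" by simp
  then obtain b l where "u = b * x + l" "l \<in> L" by (auto simp: I_def)
  then have "b * x - u \<in> L" using L_minus[of l] by (simp add: algebra_simps)
  then show ?thesis using that by blast
qed

section \<open>The quotient seminorm \<open>N\<close> of A / L\<close>

definition N :: "'a \<Rightarrow> real" where "N x = infdist x L"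

lemma N_nonneg: "N x \<ge> 0"
  by (simp add: N_def infdist_nonneg)

lemma N_le: "l \<in> L \<Longrightarrow> N x \<le> norm (x - l)"
  unfolding N_def using infdist_le[of l L x] by (simp add: dist_norm)

lemma N_approx:
  assumes "e > 0" obtains l where "l \<in> L" "norm (x - l) < N x + e"
proof -
  have "\<exists>l\<in>L. dist x l < N x + e"
  proof (rule ccontr)
    assume *: "\<not> ?thesis"
    have "N x + e \<le> infdist x L"
      unfolding infdist_def using L_zero * by (auto intro!: cINF_greatest simp: not_less)
    then show False using assms by (simp add: N_def)
  qed
  then show ?thesis using that by (auto simp: dist_norm)
qed

lemma N_add: "N (x + y) \<le> N x + N y"
proof (rule field_le_epsilon)
  fix e :: real assume e: "e > 0"
  obtain l where l: "l \<in> L" "norm (x - l) < N x + e/2" using N_approx[of "e/2"] e by auto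
  obtain m where m: "m \<in> L" "norm (y - m) < N y + e/2" using N_approx[of "e/2"] e by auto
  have "N (x + y) \<le> norm ((x + y) - (l + m))" using l m by (intro N_le L_add)
  also have "\<dots> \<le> norm (x - l) + norm (y - m)"
    using norm_triangle_ineq[of "x - l" "y - m"] by (simp add: algebra_simps)
  finally show "N (x + y) \<le> N x + N y + e" using l m by linarith
qed

text \<open>As \<open>L\<close> is two-sided, \<open>(x - l) * (y - m)\<close> represents the class
  of \<open>x * y\<close> whenever \<open>l\<close> and \<open>m\<close> lie in
  \<open>L\<close>.\<close>

lemma N_mult: "N (x * y) \<le> N x * N y"
proof (rule field_le_epsilon)
  fix e :: real assume e: "e > 0"
  have "((\<lambda>t. (N x + t) * (N y + t)) \<longlongrightarrow> (N x + 0) * (N y + 0)) (at_right 0)"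
    by (intro tendsto_intros)
  then have "\<forall>\<^sub>F t in at_right 0. (N x + t) * (N y + t) < N x * N y + e"
    using e by (intro order_tendstoD(2)[where y = "(N x + 0) * (N y + 0)"]) auto
  moreover have "\<forall>\<^sub>F t in at_right 0. (t::real) > 0" by (rule eventually_at_right_less)
  ultimately have "\<forall>\<^sub>F t in at_right 0. (t::real) > 0 \<and> (N x + t) * (N y + t) < N x * N y + e"
    by eventually_elim auto
  then obtain t :: real where t: "t > 0" "(N x + t) * (N y + t) < N x * N y + e"
    using eventually_happens trivial_limit_at_right_real by blast
  obtain l where l: "l \<in> L" "norm (x - l) < N x + t" using N_approx t by auto
  obtain m where m: "m \<in> L" "norm (y - m) < N y + t" using N_approx t by auto
  have "l * y + (x - l) * m \<in> L" using l m by (intro L_add L_left L_right)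
  then have "N (x * y) \<le> norm (x * y - (l * y + (x - l) * m))" by (rule N_le)
  also have "x * y - (l * y + (x - l) * m) = (x - l) * (y - m)" by (simp add: algebra_simps)
  also have "norm \<dots> \<le> norm (x - l) * norm (y - m)" by (rule norm_mult_ineq)
  also have "\<dots> \<le> (N x + t) * (N y + t)"
    using l m t N_nonneg by (intro mult_mono) (auto intro: add_nonneg_nonneg less_imp_le)
  finally show "N (x * y) \<le> N x * N y + e" using t by linarith
qed

lemma N_cong:
  assumes "x - y \<in> L" shows "N x = N y"
proof -
  have "N x \<le> N y" if "x - y \<in> L" for x y
  proof -
    have "N (x - y) \<le> norm ((x - y) - (x - y))" by (rule N_le[OF that])
    then show ?thesis using N_add[of "x - y" y] by simp
  qed
  from this[OF assms] this[of y x] show ?thesis using L_minus[OF assms] by simp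
qed

lemma N_sm: "N (sm c x) = norm c * N x"
proof -
  have le: "N (sm c x) \<le> norm c * N x" for c x
  proof (rule field_le_epsilon)
    fix e :: real assume e: "e > 0"
    define t where "t = e / (norm c + 1)"
    have "norm c + 1 > 0" using norm_ge_zero[of c] by linarith
    then have t: "t > 0" "norm c * t \<le> e"
      using e by (auto simp: t_def field_simps)
    obtain l where l: "l \<in> L" "norm (x - l) < N x + t" using N_approx t by auto
    have "N (sm c x) \<le> norm (sm c x - sm c l)" using l by (intro N_le L_sm)
    also have "\<dots> = norm c * norm (x - l)" by (simp flip: vs.scale_right_diff_distrib add: norm_sm)
    also have "\<dots> \<le> norm c * (N x + t)" using l by (intro mult_left_mono) auto
    finally show "N (sm c x) \<le> norm c * N x + e" using t by (simp add: algebra_simps)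
  qed
  show ?thesis
  proof (cases "c = 0")
    case True
    then show ?thesis using N_le[OF L_zero, of 0] N_nonneg[of 0] by simp
  next
    case False
    have "norm c * N x \<le> norm c * (norm (inverse c) * N (sm c x))"
      using le[of "inverse c" "sm c x"] False by (intro mult_left_mono) auto
    also have "\<dots> = N (sm c x)" using False by (simp add: norm_inverse)
    finally show ?thesis using le[of c x] by simp
  qed
qed

lemma N_minus: "N (- x) = N x"
  using N_sm[of "-1" x] by simp

lemma N_diff: "N (x - y) \<le> N x + N y"
  using N_add[of x "- y"] by (simp add: N_minus)

text \<open>Otherwise some \<open>a = u - l\<close> has norm below 1 and a quasi-inverse
  \<open>b\<close>. Then \<open>a = b * a - b\<close> is congruent to \<open>b * u - b\<close>,
  hence to 0, which puts \<open>u\<close> in \<open>L\<close>.\<close>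

lemma N_unit: "N u \<ge> 1"
proof (rule ccontr)
  assume "\<not> ?thesis"
  then obtain l where l: "l \<in> L" "norm (u - l) < 1"
    using N_approx[of "1 - N u" u] by auto
  define a where "a = u - l"
  obtain b where b: "a + b = a * b" "a * b = b * a"
    using quasi_inverse_exists[of a] l by (auto simp: a_def)
  have "a = - (b - b * u) - b * l"
    using b unfolding a_def by (metis (no_types, opaque_lifting) add_diff_cancel_right' diff_diff_eq minus_diff_eq right_diff_distrib add.commute diff_diff_eq2)
  then have "a \<in> L" using L_diff[OF L_minus[OF modular] L_left[OF l(1)]] by metis
  then have "u \<in> L" using L_add[OF _ l(1), of a] by (simp add: a_def)
  then show False using unit_notin by simp
qed

text \<open>If \<open>a - sm z u\<close> were never in \<open>L\<close>, it would have an inverse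
  \<open>R z\<close> modulo \<open>L\<close> for every \<open>z\<close>. The function
  \<open>N (R z)\<close> is continuous, positive and tends to 0 at infinity; the resolvent identity
  gives it the mean inequality that excludes this. This takes the place of Liouville's
  theorem.\<close>

lemma Gelfand_Mazur: "\<exists>z. a - sm z u \<in> L"
proof (rule ccontr)
  assume "\<not> ?thesis"
  then have "\<forall>z. \<exists>b. b * (a - sm z u) - u \<in> L" using inverse_mod by metis
  then obtain R where R: "\<And>z. R z * (a - sm z u) - u \<in> L" by metis
  have res: "R z - R w - sm (z - w) (R z * R w) \<in> L" for z w
  proof -
    define X where "X = a - sm z u"
    define Y where "Y = a - sm w u"
    have YX: "Y = X + sm (z - w) u" by (simp add: X_def Y_def vs.scale_left_diff_distrib)
    have RX: "R z * X - u \<in> L" and RY: "R w * Y - u \<in> L" using R by (simp_all add: X_def Y_def)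
    \<comment> \<open>Modulo \<open>L\<close> both sides come from
      \<open>R z * (Y - X) * R w\<close>; the summands record each use of \<open>RX\<close>,
      \<open>RY\<close>, \<open>modular\<close> and \<open>comm\<close>.\<close>
    have "R z - R w - sm (z - w) (R z * R w) =
       (R z - R z * u) - R z * (R w * Y - u) - (R w - R w * u) + R w * (R z * X - u)
       + (R z * R w - R w * R z) * X - sm (z - w) (R z * R w - R z * R w * u)"
      by (simp add: YX algebra_simps sm_mult_right vs.scale_right_diff_distrib)
    also have "\<dots> \<in> L"
      by (intro L_diff L_add L_sm modular L_left L_right comm RX RY)
    finally show ?thesis .
  qed
  define g where "g = (\<lambda>z. N (R z))"
  have gpos: "g z > 0" for z
  proof -
    have "1 \<le> N (R z * (a - sm z u))" using N_cong[OF R[of z]] N_unit by simp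
    also have "\<dots> \<le> g z * N (a - sm z u)" unfolding g_def by (rule N_mult)
    finally have "g z \<noteq> 0" by auto
    then show ?thesis using N_nonneg[of "R z"] by (simp add: g_def)
  qed
  have gdiff: "g z - g w \<le> norm (z - w) * (g z * g w)" for z w
  proof -
    have "N (R z - R w) = norm (z - w) * N (R z * R w)"
      using N_cong[OF res[of z w]] by (simp add: N_sm)
    also have "\<dots> \<le> norm (z - w) * (g z * g w)"
      unfolding g_def by (intro mult_left_mono N_mult) auto
    finally show ?thesis using N_add[of "R z - R w" "R w"] by (simp add: g_def)
  qed
  \<comment> \<open>Dividing \<open>gdiff\<close> by \<open>g z * g w\<close> makes
    \<open>1 / g\<close> Lipschitz, which gives continuity of \<open>g\<close> without a prior local
    bound.\<close>
  have lip: "\<bar>1 / g z - 1 / g w\<bar> \<le> norm (z - w)" for z w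
  proof -
    have "1 / g z - 1 / g w \<le> norm (z - w)" for z w
      using gdiff[of w z] gpos[of z] gpos[of w] by (simp add: field_simps norm_minus_commute)
    from this[of z w] this[of w z] show ?thesis by (simp add: abs_le_iff norm_minus_commute)
  qed
  have cont: "continuous_on UNIV g"
  proof -
    have "1-lipschitz_on UNIV (\<lambda>z. 1 / g z)"
      by (rule lipschitz_onI) (use lip in \<open>auto simp: dist_norm\<close>)
    then have "continuous_on UNIV (\<lambda>z. 1 / (1 / g z))"
      using gpos by (intro continuous_intros lipschitz_on_continuous_on) (auto simp: less_imp_neq[symmetric])
    then show ?thesis by simp
  qed
  have "(g \<longlongrightarrow> 0) at_infinity"
  proof (rule Lim_null_comparison)
    show "\<forall>\<^sub>F z in at_infinity. norm (g z) \<le> N u / (norm z - N a)"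
      unfolding eventually_at_infinity
    proof (intro exI[of _ "N a + 1"] allI impI)
      fix z :: complex assume z: "norm z \<ge> N a + 1"
      \<comment> \<open>The defining congruence of \<open>R z\<close>, solved for
        \<open>z R z\<close>, bounds \<open>norm z * g z\<close> by
        \<open>g z * N a + N u\<close>.\<close>
      have "sm z (R z) - (R z * a - u) = sm z (R z - R z * u) - (R z * (a - sm z u) - u)"
        by (simp add: algebra_simps vs.scale_right_diff_distrib sm_mult_right)
      also have "\<dots> \<in> L" by (intro L_diff L_sm modular R)
      finally have "norm z * g z = N (R z * a - u)" using N_cong N_sm by (metis g_def)
      also have "\<dots> \<le> g z * N a + N u"
        using N_diff[of "R z * a" u] N_mult[of "R z" a] by (simp add: g_def)
      finally show "norm (g z) \<le> N u / (norm z - N a)"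
        using z gpos[of z] by (simp add: field_simps)
    qed
    have "filterlim (\<lambda>z::complex. - N a + norm z) at_top at_infinity"
      by (rule filterlim_tendsto_add_at_top[OF tendsto_const filterlim_norm_at_top])
    then show "((\<lambda>z::complex. N u / (norm z - N a)) \<longlongrightarrow> 0) at_infinity"
      by (intro tendsto_divide_0[OF tendsto_const] filterlim_at_top_imp_at_infinity) simp
  qed
  moreover have "4 * g z \<le> (1 + (g z) ^ 4 * r ^ 4) *
      (g (z + of_real r) + g (z + \<i> * of_real r) + g (z - of_real r) + g (z - \<i> * of_real r))"
    if r: "r > 0" for z r
  proof -
    \<comment> \<open>\<open>T k\<close> and \<open>s k\<close> are sums over the four points \<open>w\<close> with \<open>w\<^sup>4 = r\<^sup>4\<close>, where \<open>s 1 = s 2 = s 3 = 0\<close>;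
      the resolvent identity relates \<open>T k\<close> to \<open>T (k + 1)\<close>, and \<open>T 4 = r\<^sup>4 T 0\<close>.\<close>
    define T where "T = (\<lambda>k. sm (of_real r ^ k) (R (z + of_real r)) + sm ((\<i> * of_real r) ^ k) (R (z + \<i> * of_real r))
       + sm ((- of_real r) ^ k) (R (z - of_real r)) + sm ((- (\<i> * of_real r)) ^ k) (R (z - \<i> * of_real r)))"
    define s where "s = (\<lambda>k. (of_real r ^ k + (\<i> * of_real r) ^ k + (- of_real r) ^ k + (- (\<i> * of_real r)) ^ k :: complex))"
    have tk: "T k - sm (s k) (R z) - T (Suc k) * R z \<in> L" for k
    proof -
      have one: "sm (w ^ k) (R (z + w)) - sm (w ^ k) (R z) - sm (w ^ Suc k) (R (z + w)) * R z \<in> L" for w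
        using L_sm[OF res[of "z + w" z], of "w ^ k"]
        by (simp add: vs.scale_right_diff_distrib sm_mult_left mult.commute)
      have "T k - sm (s k) (R z) - T (Suc k) * R z =
         (sm ((of_real r) ^ k) (R (z + of_real r)) - sm (of_real r ^ k) (R z) - sm (of_real r ^ Suc k) (R (z + of_real r)) * R z)
       + (sm ((\<i> * of_real r) ^ k) (R (z + \<i> * of_real r)) - sm ((\<i> * of_real r) ^ k) (R z) - sm ((\<i> * of_real r) ^ Suc k) (R (z + \<i> * of_real r)) * R z)
       + (sm ((- of_real r) ^ k) (R (z + - of_real r)) - sm ((- of_real r) ^ k) (R z) - sm ((- of_real r) ^ Suc k) (R (z + - of_real r)) * R z)
       + (sm ((- (\<i> * of_real r)) ^ k) (R (z + - (\<i> * of_real r))) - sm ((- (\<i> * of_real r)) ^ k) (R z) - sm ((- (\<i> * of_real r)) ^ Suc k) (R (z + - (\<i> * of_real r))) * R z)"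
        unfolding T_def s_def by (simp only: vs.scale_left_distrib distrib_right diff_conv_add_uminus) (simp add: algebra_simps del: power_Suc)
      also have "\<dots> \<in> L" by (intro L_add one)
      finally show ?thesis .
    qed
    have s: "s 0 = 4" "s 1 = 0" "s 2 = 0" "s 3 = 0"
      by (simp_all add: s_def power2_eq_square power3_eq_cube algebra_simps)
    have T4: "T 4 = sm (of_real (r ^ 4)) (T 0)"
    proof -
      have "(\<i> * complex_of_real r) ^ 4 = of_real (r ^ 4)" by (simp add: power_mult_distrib)
      then show ?thesis by (simp add: T_def vs.scale_right_distrib)
    qed
    have shift: "N (T k) \<le> N (T (Suc k)) * g z" if "s k = 0" for k
    proof -
      have "N (T k) = N (T (Suc k) * R z)" using N_cong[of "T k" "T (Suc k) * R z"] tk[of k] that by simp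
      then show ?thesis using N_mult[of "T (Suc k)" "R z"] by (simp add: g_def)
    qed
    have "N (T 0 - sm 4 (R z)) = N (T 1 * R z)"
      using tk[of 0] s by (intro N_cong) simp
    also have "\<dots> \<le> N (T 1) * g z" unfolding g_def by (rule N_mult)
    also have "\<dots> \<le> (N (T 2) * g z) * g z"
      using shift[of 1] s gpos[of z] by (intro mult_right_mono) (auto simp: numeral_2_eq_2)
    also have "\<dots> \<le> (N (T 3) * g z) * g z * g z"
      using shift[of 2] s gpos[of z] by (intro mult_right_mono) (auto simp: numeral_3_eq_3 numeral_2_eq_2)
    also have "\<dots> \<le> (N (T 4) * g z) * g z * g z * g z"
      using shift[of 3] s gpos[of z] by (intro mult_right_mono) (auto simp: eval_nat_numeral)
    also have "\<dots> = (g z) ^ 4 * r ^ 4 * N (T 0)"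
      using r by (simp add: T4 N_sm norm_power norm_mult power4_eq_xxxx)
    finally have "N (T 0 - sm 4 (R z)) \<le> (g z) ^ 4 * r ^ 4 * N (T 0)" .
    moreover have "4 * g z \<le> N (T 0) + N (T 0 - sm 4 (R z))"
      using N_diff[of "T 0" "T 0 - sm 4 (R z)"] by (simp add: N_sm g_def)
    ultimately have "4 * g z \<le> (1 + (g z) ^ 4 * r ^ 4) * N (T 0)" by (simp add: algebra_simps)
    also have "\<dots> \<le> (1 + (g z) ^ 4 * r ^ 4) * 
      (g (z + of_real r) + g (z + \<i> * of_real r) + g (z - of_real r) + g (z - \<i> * of_real r))"
    proof (intro mult_left_mono)
      show "N (T 0) \<le> g (z + of_real r) + g (z + \<i> * of_real r) + g (z - of_real r) + g (z - \<i> * of_real r)"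
        unfolding T_def g_def by simp (intro order_trans[OF N_add] add_mono order_refl)
      show "0 \<le> 1 + g z ^ 4 * r ^ 4" using gpos[of z] r by (intro add_nonneg_nonneg) auto
    qed
    finally show ?thesis .
  qed
  ultimately show False
    using approx_subharmonic_not_vanishing_at_infinity[OF cont gpos] by blast
qed

end

subsection \<open>Characters\<close>

definition (in complex_banach_alg) character :: "('a \<Rightarrow> complex) \<Rightarrow> bool" where
  "character \<phi> \<longleftrightarrow> (\<forall>x y. \<phi> (x + y) = \<phi> x + \<phi> y) \<and> (\<forall>c x. \<phi> (sm c x) = c * \<phi> x) \<and>
     (\<forall>x y. \<phi> (x * y) = \<phi> x * \<phi> y) \<and> (\<exists>x. \<phi> x \<noteq> 0)"

text \<open>\<open>\<phi> a\<close> is the scalar supplied by \<open>Gelfand_Mazur\<close>. It is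
  unique because \<open>u\<close> is not in \<open>L\<close>, and uniqueness turns the congruences
  for sums and products into equations.\<close>

lemma (in maximal_modular_ideal) kernel_of_character:
  obtains \<phi> where "character \<phi>" "\<And>x. \<phi> x = 0 \<longleftrightarrow> x \<in> L"
proof -
  obtain \<phi> where \<phi>: "\<And>a. a - sm (\<phi> a) u \<in> L" using Gelfand_Mazur by metis
  have eqI: "\<phi> a = z" if "a - sm z u \<in> L" for a z
  proof (rule ccontr)
    assume ne: "\<phi> a \<noteq> z"
    have "sm (\<phi> a - z) u \<in> L"
      using L_diff[OF that \<phi>[of a]] by (simp add: vs.scale_left_diff_distrib)
    from L_sm[OF this, of "inverse (\<phi> a - z)"] have "u \<in> L" using ne by simp
    then show False using unit_notin by simp
  qed
  have "\<phi> (x + y) = \<phi> x + \<phi> y" for x y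
    using L_add[OF \<phi>[of x] \<phi>[of y]] by (intro eqI) (simp add: vs.scale_left_distrib algebra_simps)
  moreover have "\<phi> (sm c x) = c * \<phi> x" for c x
    using L_sm[OF \<phi>[of x], of c] by (intro eqI) (simp add: vs.scale_right_diff_distrib)
  moreover have "\<phi> (x * y) = \<phi> x * \<phi> y" for x y
  proof (rule eqI)
    have "x * y - sm (\<phi> x * \<phi> y) u =
       (x - sm (\<phi> x) u) * y + sm (\<phi> x) (u * (y - sm (\<phi> y) u)) - sm (\<phi> x * \<phi> y) (u - u * u)"
      by (simp add: algebra_simps vs.scale_right_diff_distrib vs.scale_right_distrib sm_mult_left sm_mult_right)
    also have "\<dots> \<in> L" by (intro L_diff L_add L_sm L_left L_right \<phi> modular)
    finally show "x * y - sm (\<phi> x * \<phi> y) u \<in> L" .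
  qed
  moreover have "\<phi> u = 1" by (rule eqI) (simp add: L_zero)
  ultimately have "character \<phi>" unfolding character_def by (metis zero_neq_one)
  moreover have "\<phi> x = 0 \<longleftrightarrow> x \<in> L" for x
    using eqI[of x 0] \<phi>[of x] by auto
  ultimately show ?thesis using that by blast
qed

context complex_banach_alg
begin

context
  fixes \<phi> assumes char: "character \<phi>"
begin

lemma character_add: "\<phi> (x + y) = \<phi> x + \<phi> y"
  and character_sm: "\<phi> (sm c x) = c * \<phi> x"
  and character_mult: "\<phi> (x * y) = \<phi> x * \<phi> y"
  using char by (simp_all add: character_def)

lemma character_zero: "\<phi> 0 = 0"
  using character_add[of 0 0] by simp

lemma character_minus: "\<phi> (- x) = - \<phi> x"
  using character_add[of x "- x"] by (simp add: character_zero add_eq_0_iff)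

lemma character_diff: "\<phi> (x - y) = \<phi> x - \<phi> y"
  using character_add[of x "- y"] by (simp add: character_minus)

lemma character_scaleR: "\<phi> (r *\<^sub>R x) = r *\<^sub>R \<phi> x"
  using character_sm[of "of_real r" x] by (simp add: sm_of_real scaleR_conv_of_real)

lemma character_unit: obtains u where "\<phi> u = 1"
proof -
  obtain x where "\<phi> x \<noteq> 0" using char by (auto simp: character_def)
  then have "\<phi> (sm (inverse (\<phi> x)) x) = 1" by (simp add: character_sm)
  then show ?thesis using that by blast
qed

text \<open>Otherwise a multiple \<open>a\<close> of \<open>x\<close> has norm below 1 and
  \<open>\<phi> a = 1\<close>; its quasi-inverse \<open>b\<close> would give
  \<open>1 + \<phi> b = \<phi> b\<close>.\<close>

lemma character_norm_le: "norm (\<phi> x) \<le> norm x"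
proof (rule ccontr)
  assume *: "\<not> ?thesis"
  then have nz: "norm (\<phi> x) > 0" using norm_ge_zero[of x] by linarith
  define a where "a = sm (inverse (\<phi> x)) x"
  have "norm a < 1" using * nz by (simp add: a_def norm_sm norm_inverse inverse_eq_divide norm_divide)
  then obtain b where "a + b = a * b" using quasi_inverse_exists by blast
  then have "\<phi> a + \<phi> b = \<phi> a * \<phi> b" by (metis character_add character_mult)
  moreover have "\<phi> a = 1" using nz by (simp add: a_def character_sm)
  ultimately show False by simp
qed

lemma character_bounded_linear: "bounded_linear \<phi>"
  by (rule bounded_linear_intro[where K = 1]) (simp_all add: character_add character_scaleR character_norm_le)

end

text \<open>If the kernel of \<open>\<phi>\<close> lay in that of \<open>\<psi>\<close>, then
  \<open>\<psi>\<close> would be a multiple of \<open>\<phi>\<close>, and multiplicativity would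
  force the factor \<open>\<psi> u\<close> to be 1.\<close>

lemma characters_separate:
  assumes \<phi>: "character \<phi>" and \<psi>: "character \<psi>" and "\<phi> \<noteq> \<psi>"
  obtains w where "\<phi> w = 0" "\<psi> w = 1"
proof -
  have "\<exists>w. \<phi> w = 0 \<and> \<psi> w \<noteq> 0"
  proof (rule ccontr)
    assume *: "\<not> ?thesis"
    obtain u where u: "\<phi> u = 1" using character_unit[OF \<phi>] by blast
    have eq: "\<psi> x = \<phi> x * \<psi> u" for x
    proof -
      have "\<phi> (x - sm (\<phi> x) u) = 0" by (simp add: character_diff[OF \<phi>] character_sm[OF \<phi>] u)
      then have "\<psi> (x - sm (\<phi> x) u) = 0" using * by blast
      then show ?thesis by (simp add: character_diff[OF \<psi>] character_sm[OF \<psi>])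
    qed
    have "\<psi> u * \<psi> u = \<psi> u"
      using eq[of "u * u"] by (simp add: character_mult[OF \<phi>] character_mult[OF \<psi>] u)
    moreover have "\<psi> u \<noteq> 0" using eq \<psi> unfolding character_def by (metis mult_zero_right)
    ultimately have "\<psi> u = 1" by simp
    then have "\<phi> = \<psi>" using eq by (metis ext mult.right_neutral)
    then show False using assms by simp
  qed
  then obtain w where w: "\<phi> w = 0" "\<psi> w \<noteq> 0" by blast
  then show ?thesis
    using that[of "sm (inverse (\<psi> w)) w"] by (simp add: character_sm[OF \<phi>] character_sm[OF \<psi>])
qed

lemma character_isolating_finite:
  assumes "finite F" and "\<And>\<phi>. \<phi> \<in> F \<Longrightarrow> character \<phi>" and \<psi>: "character \<psi>" and "\<psi> \<notin> F"
  obtains e where "\<psi> e = 1" "\<And>\<phi>. \<phi> \<in> F \<Longrightarrow> \<phi> e = 0"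
proof -
  have "\<exists>e. \<psi> e = 1 \<and> (\<forall>\<phi>\<in>F. \<phi> e = 0)"
    using assms(1,2,4)
  proof (induction F rule: finite_induct)
    case empty
    then show ?case using character_unit[OF \<psi>] by auto
  next
    case (insert \<phi> F)
    then obtain e where e: "\<psi> e = 1" "\<forall>\<phi>\<in>F. \<phi> e = 0" by auto
    obtain w where "\<phi> w = 0" "\<psi> w = 1"
      using characters_separate[of \<phi> \<psi>] insert.prems \<psi> by auto
    then have "\<psi> (e * w) = 1 \<and> (\<forall>\<theta>\<in>insert \<phi> F. \<theta> (e * w) = 0)"
      using e insert.prems by (auto simp: character_mult[OF \<psi>] character_mult)
    then show ?case by blast
  qed
  then show ?thesis using that by blast
qed

end

subsection \<open>Derivations modulo the radical\<close>

locale radical_derivation = complex_banach_alg sm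
  for sm :: "complex \<Rightarrow> 'a::{real_normed_algebra,banach} \<Rightarrow> 'a" +
  fixes d :: "'a \<Rightarrow> 'a"
  assumes rad: "jacobson_radical sm = right_annihilator"
    and comm: "a * b - b * a \<in> jacobson_radical sm"
    and der: "derivation sm d"
begin

lemma d_add: "d (x + y) = d x + d y"
  and d_sm: "d (sm c x) = sm c (d x)"
  and d_mult: "d (x * y) = d x * y + x * d y"
  using der by (simp_all add: derivation_def)

lemma d_zero: "d 0 = 0"
  using d_add[of 0 0] by simp

lemma d_minus: "d (- x) = - d x"
  using d_add[of x "- x"] by (simp add: d_zero add_eq_0_iff)

lemma d_diff: "d (x - y) = d x - d y"
  using d_add[of x "- y"] by (simp add: d_minus)

lemma d_scaleR: "d (r *\<^sub>R x) = r *\<^sub>R d x"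
  using d_sm[of "of_real r" x] by (simp add: sm_of_real)

lemma d_linear: "linear d"
  by (rule linearI) (simp_all add: d_add d_scaleR)

text \<open>Forwards, \<open>u * x = 0\<close> for a \<open>u\<close> with
  \<open>\<phi> u = 1\<close>. Backwards, commutators lie in every maximal modular left ideal, so
  each such ideal is the kernel of a character.\<close>

lemma radical_iff: "x \<in> jacobson_radical sm \<longleftrightarrow> (\<forall>\<phi>. character \<phi> \<longrightarrow> \<phi> x = 0)"
proof
  assume x: "x \<in> jacobson_radical sm"
  show "\<forall>\<phi>. character \<phi> \<longrightarrow> \<phi> x = 0"
  proof (intro allI impI)
    fix \<phi> assume \<phi>: "character \<phi>"
    obtain u where u: "\<phi> u = 1" using character_unit[OF \<phi>] by blast
    have "u * x = 0" using x by (simp add: rad right_annihilator_def)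
    then show "\<phi> x = 0" using character_mult[OF \<phi>, of u x] u by (simp add: character_zero[OF \<phi>])
  qed
next
  assume x: "\<forall>\<phi>. character \<phi> \<longrightarrow> \<phi> x = 0"
  show "x \<in> jacobson_radical sm"
    unfolding jacobson_radical_def
  proof clarify
    fix L assume L: "maximal_modular_left_ideal sm L"
    then obtain u where u: "\<And>a. a - a * u \<in> L"
      by (auto simp: maximal_modular_left_ideal_def modular_left_ideal_def)
    have "jacobson_radical sm \<subseteq> L" using L by (auto simp: jacobson_radical_def)
    then interpret maximal_modular_ideal sm L u
      using L u comm by unfold_locales auto
    obtain \<phi> where "character \<phi>" "\<And>x. \<phi> x = 0 \<longleftrightarrow> x \<in> L" using kernel_of_character by blast
    then show "x \<in> L" using x by blast
  qed
qed

lemma character_d_mult: "character \<phi> \<Longrightarrow> \<phi> (d (x * y)) = \<phi> (d x) * \<phi> y + \<phi> x * \<phi> (d y)"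
  by (simp add: d_mult character_add character_mult)

text \<open>Apply \<open>\<phi> \<circ> d\<close> to \<open>u * x = 0\<close> with
  \<open>\<phi> u = 1\<close>.\<close>

lemma d_radical: "x \<in> jacobson_radical sm \<Longrightarrow> d x \<in> jacobson_radical sm"
  unfolding radical_iff
proof (intro allI impI)
  fix \<phi> assume x: "\<forall>\<phi>. character \<phi> \<longrightarrow> \<phi> x = 0" and \<phi>: "character \<phi>"
  obtain u where u: "\<phi> u = 1" using character_unit[OF \<phi>] by blast
  have "x \<in> right_annihilator" using x radical_iff rad by blast
  then have "d (u * x) = 0" by (simp add: right_annihilator_def d_zero)
  moreover have "\<phi> x = 0" using x \<phi> by blast
  ultimately show "\<phi> (d x) = 0"
    using character_d_mult[OF \<phi>, of u x] u by (simp add: character_zero[OF \<phi>])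
qed

section \<open>Automatic continuity modulo the radical\<close>

definition discontinuous_characters :: "('a \<Rightarrow> complex) set" where
  "discontinuous_characters = {\<phi>. character \<phi> \<and> (\<nexists>C. \<forall>x. norm (\<phi> (d x)) \<le> C * norm x)}"

text \<open>For infinitely many such characters, \<open>gliding_hump\<close> bounds some
  \<open>\<phi> n (d (W n x))\<close>. This is a nonzero multiple of \<open>\<phi> n (d x)\<close>
  plus a multiple of \<open>\<phi> n x\<close>, so \<open>\<phi> n \<circ> d\<close> would be
  bounded after all.\<close>

lemma finite_discontinuous_characters: "finite discontinuous_characters"
proof (rule ccontr)
  assume "infinite discontinuous_characters"
  then obtain \<phi> :: "nat \<Rightarrow> 'a \<Rightarrow> complex" where inj: "inj \<phi>" and ran: "range \<phi> \<subseteq> discontinuous_characters"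
    using infinite_countable_subset by blast
  have \<phi>: "character (\<phi> n)" and unb: "\<nexists>C. \<forall>x. norm (\<phi> n (d x)) \<le> C * norm x" for n
    using ran by (auto simp: discontinuous_characters_def)
  \<comment> \<open>Diagonal pairs ask for \<open>\<phi> m p\<close> to be nonzero, the other pairs
    for \<open>\<phi> m p\<close> and \<open>\<phi> n p\<close> to differ.\<close>
  define f where "f = (\<lambda>k x. case prod_decode k of (m, n) \<Rightarrow> if m = n then \<phi> m x else \<phi> m x - \<phi> n x)"
  have "bounded_linear (f k) \<and> (\<exists>v. f k v \<noteq> 0)" for k
  proof
    obtain m n where mn: "prod_decode k = (m, n)" by fastforce
    show "bounded_linear (f k)"
      unfolding f_def mn
      by (cases "m = n") (simp_all add: character_bounded_linear bounded_linear_sub \<phi>)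
    show "\<exists>v. f k v \<noteq> 0"
    proof (cases "m = n")
      case True
      then show ?thesis using \<phi>[of n] by (simp add: f_def mn character_def)
    next
      case False
      then have "\<phi> m \<noteq> \<phi> n" using inj by (auto dest: injD)
      then show ?thesis using False by (auto simp: f_def mn fun_eq_iff)
    qed
  qed
  then obtain p where p: "\<And>k. f k p \<noteq> 0" using common_nonvanishing_vector[of f] by blast
  have p1: "\<phi> n p \<noteq> 0" for n using p[of "prod_encode (n, n)"] by (simp add: f_def)
  have p2: "\<phi> m p \<noteq> \<phi> n p" if "m \<noteq> n" for m n
    using p[of "prod_encode (m, n)"] that by (simp add: f_def)
  \<comment> \<open>\<open>q n = p (p - \<phi> n p)\<close> up to scaling is killed by \<open>\<phi> n\<close> and by no other \<open>\<phi> m\<close>. Squaring it in \<open>R n\<close>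
    makes \<open>\<phi> n \<circ> d\<close> vanish on the range of \<open>R n\<close>.\<close>
  define q' where "q' = (\<lambda>n. p * p - sm (\<phi> n p) p)"
  define q where "q = (\<lambda>n. inverse (1 + norm (q' n)) *\<^sub>R q' n)"
  have pos: "1 + norm (q' n) > 0" for n using norm_ge_zero[of "q' n"] by linarith
  have nq: "norm (q n) \<le> 1" for n using pos[of n] by (simp add: q_def field_simps)
  have q'm: "\<phi> m (q' n) = \<phi> m p * (\<phi> m p - \<phi> n p)" for m n
    by (simp add: q'_def character_diff[OF \<phi>] character_mult[OF \<phi>] character_sm[OF \<phi>] algebra_simps)
  have q0: "\<phi> n (q n) = 0" for n by (simp add: q_def character_scaleR[OF \<phi>] q'm)
  have q1: "\<phi> m (q n) \<noteq> 0" if "m \<noteq> n" for m n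
    using p1[of m] p2[OF that] pos[of n] by (simp add: q_def character_scaleR[OF \<phi>] q'm)
  define R where "R = (\<lambda>n x. q n * (q n * x))"
  define W where "W = rec_nat (\<lambda>x. x) (\<lambda>n w x. w (R n x))"
  have W0: "W 0 x = x" and WS: "W (Suc n) x = W n (R n x)" for n x by (simp_all add: W_def)
  have \<phi>R: "\<phi> m (R n x) = (\<phi> m (q n))\<^sup>2 * \<phi> m x"
    and \<phi>dR: "\<phi> m (d (R n x)) = (\<phi> m (q n))\<^sup>2 * \<phi> m (d x) + 2 * \<phi> m (q n) * \<phi> m (d (q n)) * \<phi> m x" for m n x
    by (simp_all add: R_def character_d_mult[OF \<phi>] character_mult[OF \<phi>] power2_eq_square algebra_simps)
  \<comment> \<open>\<open>a\<close> is the product of the squares of \<open>\<phi> m (q k)\<close>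
    over \<open>k < n\<close>, nonzero for \<open>n \<le> m\<close> since then every
    \<open>k\<close> differs from \<open>m\<close>; \<open>b\<close> collects the Leibniz
    terms.\<close>
  have \<phi>dW: "\<exists>a b. (\<forall>x. \<phi> m (W n x) = a * \<phi> m x \<and> \<phi> m (d (W n x)) = a * \<phi> m (d x) + b * \<phi> m x) \<and> (n \<le> m \<longrightarrow> a \<noteq> 0)" for m n
  proof (induction n)
    case 0
    show ?case by (rule exI[of _ 1], rule exI[of _ 0]) (simp add: W0)
  next
    case (Suc n)
    then obtain a b where ab: "\<And>x. \<phi> m (W n x) = a * \<phi> m x" "\<And>x. \<phi> m (d (W n x)) = a * \<phi> m (d x) + b * \<phi> m x"
      "n \<le> m \<Longrightarrow> a \<noteq> 0" by blast
    show ?case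
      by (rule exI[of _ "a * (\<phi> m (q n))\<^sup>2"],
          rule exI[of _ "a * (2 * \<phi> m (q n) * \<phi> m (d (q n))) + b * (\<phi> m (q n))\<^sup>2"])
         (use q1[of m n] ab in \<open>auto simp: WS \<phi>R \<phi>dR algebra_simps\<close>)
  qed
  obtain n C where C: "\<And>x. norm (\<phi> n (d (W n x))) \<le> C * norm x"
  proof (rule gliding_hump[of "\<lambda>n x. \<phi> n (d x)" R W])
    fix n x
    show "linear (\<lambda>x. \<phi> n (d x))"
      using linear_compose[OF d_linear bounded_linear.linear[OF character_bounded_linear[OF \<phi>]]]
      by (simp add: o_def)
    show "\<exists>B. \<forall>n. norm (\<phi> n (d x)) \<le> B" using character_norm_le[OF \<phi>] by blast
    show "bounded_linear (R n)"
      unfolding R_def by (intro bounded_linear_const_mult bounded_linear_ident)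
    have "norm (q n * y) \<le> norm y" for y
    proof -
      have "norm (q n * y) \<le> norm (q n) * norm y" by (rule norm_mult_ineq)
      also have "\<dots> \<le> 1 * norm y" by (intro mult_right_mono nq) auto
      finally show ?thesis by simp
    qed
    from this[of "q n * x"] this[of x] show "norm (R n x) \<le> norm x" by (simp add: R_def)
    obtain a b where "\<phi> n (d (W n (R n x))) = a * \<phi> n (d (R n x)) + b * \<phi> n (R n x)"
      using \<phi>dW by blast
    then show "\<phi> n (d (W (Suc n) x)) = 0" by (simp add: WS \<phi>R \<phi>dR q0)
    show "W 0 x = x" by (rule W0)
    show "W (Suc n) x = W n (R n x)" by (rule WS)
  qed (rule that)
  obtain a b where ab: "\<And>x. \<phi> n (d (W n x)) = a * \<phi> n (d x) + b * \<phi> n x" and a: "a \<noteq> 0"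
    using \<phi>dW[of n n] by blast
  have "norm (\<phi> n (d x)) \<le> ((C + norm b) / norm a) * norm x" for x
  proof -
    have "norm a * norm (\<phi> n (d x)) = norm (\<phi> n (d (W n x)) - b * \<phi> n x)"
      by (simp add: ab norm_mult)
    also have "\<dots> \<le> norm (\<phi> n (d (W n x))) + norm b * norm (\<phi> n x)"
      using norm_triangle_ineq4[of "\<phi> n (d (W n x))" "b * \<phi> n x"] by (simp add: norm_mult)
    also have "\<dots> \<le> C * norm x + norm b * norm x"
      by (intro add_mono C mult_left_mono character_norm_le[OF \<phi>]) auto
    finally show ?thesis using a by (simp add: field_simps)
  qed
  then show False using unb by blast
qed

text \<open>If only finitely many characters fail to vanish on \<open>v\<close>, then one of them, \<open>\<psi>\<close>, is cut out by an
  element \<open>e\<close> that is idempotent modulo the radical. Derivations kill idempotents of a commutative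
  algebra, and \<open>e x \<equiv> \<psi> x e\<close>.\<close>

lemma isolated_character_derivation_zero:
  assumes fin: "finite F" and F: "\<And>\<phi>. \<phi> \<in> F \<Longrightarrow> character \<phi>" and \<psi>: "character \<psi>" "\<psi> v \<noteq> 0"
    and v: "\<And>\<phi>. character \<phi> \<Longrightarrow> \<phi> \<notin> F \<Longrightarrow> \<phi> v = 0"
  shows "\<psi> (d x) = 0"
proof -
  obtain w where w: "\<psi> w = 1" "\<And>\<phi>. \<phi> \<in> F - {\<psi>} \<Longrightarrow> \<phi> w = 0"
    using character_isolating_finite[of "F - {\<psi>}" \<psi>] fin F \<psi> by auto
  \<comment> \<open>\<open>w\<close> kills the other members of \<open>F\<close> and
    \<open>v\<close> the characters outside \<open>F\<close>, so only \<open>\<psi>\<close> survives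
    on \<open>e\<close>.\<close>
  define e where "e = sm (inverse (\<psi> v)) (w * v)"
  have e1: "\<psi> e = 1" using w \<psi> by (simp add: e_def character_sm character_mult)
  have e0: "\<phi> e = 0" if "character \<phi>" "\<phi> \<noteq> \<psi>" for \<phi>
    using w(2)[of \<phi>] v[of \<phi>] that by (auto simp: e_def character_sm character_mult)
  have "\<phi> (e * e - e) = 0 \<and> \<phi> (e * x - sm (\<psi> x) e) = 0" if "character \<phi>" for \<phi>
    using e1 e0[OF that] that by (cases "\<phi> = \<psi>") (auto simp: character_diff character_mult character_sm)
  then have "e * e - e \<in> jacobson_radical sm" "e * x - sm (\<psi> x) e \<in> jacobson_radical sm"
    by (simp_all add: radical_iff)
  \<comment> \<open>The first equation expands to \<open>\<psi> (d e) = 0\<close>; in the second the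
    terms with \<open>\<psi> (d e)\<close> cancel, leaving \<open>\<psi> (d x)\<close>.\<close>
  then have "\<psi> (d (e * e - e)) = 0" "\<psi> (d (e * x - sm (\<psi> x) e)) = 0"
    using d_radical \<psi>(1) radical_iff by blast+
  then show ?thesis
    using e1 by (simp add: d_diff d_sm character_diff[OF \<psi>(1)] character_sm[OF \<psi>(1)] character_d_mult[OF \<psi>(1)])
qed

text \<open>For a limit point \<open>l\<close>, the defect \<open>v\<close> is killed by every
  character continuous along \<open>d\<close>. If another character \<open>\<psi>\<close> did not
  kill it, \<open>\<psi>\<close> would be isolated by \<open>v\<close>, so
  \<open>\<psi> \<circ> d\<close> would be 0 and hence bounded, a contradiction.\<close>

lemma derivation_closed_mod_radical: "closed {(x, y). d x - y \<in> jacobson_radical sm}" (is "closed ?G")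
  unfolding closed_sequential_limits
proof (intro allI impI, elim conjE)
  fix s l assume s: "\<forall>n. s n \<in> ?G" and lim: "s \<longlonglongrightarrow> l"
  define v where "v = d (fst l) - snd l"
  have v0: "\<phi> v = 0" if \<phi>: "character \<phi>" and cont: "\<phi> \<notin> discontinuous_characters" for \<phi>
  proof -
    obtain C where C: "\<And>x. norm (\<phi> (d x)) \<le> C * norm x"
      using \<phi> cont unfolding discontinuous_characters_def by blast
    have "bounded_linear (\<lambda>x. \<phi> (d x))"
      by (rule bounded_linear_intro[where K = C])
         (use C in \<open>auto simp: d_add d_scaleR character_add[OF \<phi>] character_scaleR[OF \<phi>] mult.commute\<close>)
    then have "(\<lambda>n. \<phi> (d (fst (s n)))) \<longlonglongrightarrow> \<phi> (d (fst l))"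
      by (rule bounded_linear.tendsto) (intro tendsto_fst lim)
    moreover have "(\<lambda>n. \<phi> (snd (s n))) \<longlonglongrightarrow> \<phi> (snd l)"
      by (intro bounded_linear.tendsto[OF character_bounded_linear[OF \<phi>]] tendsto_snd lim)
    moreover have "\<phi> (d (fst (s n))) = \<phi> (snd (s n))" for n
    proof -
      have "d (fst (s n)) - snd (s n) \<in> jacobson_radical sm" using s by (auto simp: case_prod_unfold)
      then have "\<phi> (d (fst (s n)) - snd (s n)) = 0" using \<phi> radical_iff by blast
      then show ?thesis by (simp add: character_diff[OF \<phi>])
    qed
    ultimately have "\<phi> (d (fst l)) = \<phi> (snd l)" using LIMSEQ_unique by simp
    then show ?thesis by (simp add: v_def character_diff[OF \<phi>])
  qed
  have "v \<in> jacobson_radical sm"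
    unfolding radical_iff
  proof (intro allI impI, rule ccontr)
    fix \<psi> assume \<psi>: "character \<psi>" "\<psi> v \<noteq> 0"
    have "character \<phi>" if "\<phi> \<in> discontinuous_characters" for \<phi>
      using that by (simp add: discontinuous_characters_def)
    then have "\<psi> (d x) = 0" for x
      using isolated_character_derivation_zero[where F = discontinuous_characters and \<psi> = \<psi> and v = v]
        finite_discontinuous_characters \<psi> v0 by blast
    then have "\<forall>x. norm (\<psi> (d x)) \<le> 0 * norm x" by simp
    then have "\<psi> \<notin> discontinuous_characters" unfolding discontinuous_characters_def by blast
    then show False using v0 \<psi> by blast
  qed
  then show "l \<in> ?G" by (simp add: v_def case_prod_unfold)
qed

text \<open>The closed relation gives each \<open>d x\<close> a representative of norm at most
  \<open>M * norm x\<close> modulo the radical. As \<open>d\<close> preserves the radical,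
  representatives can be chosen step by step for the iterates.\<close>

lemma iterated_derivation_bounded_mod_radical:
  obtains M where "M \<ge> 0"
    "\<And>\<phi> n x. character \<phi> \<Longrightarrow> norm (\<phi> ((d ^^ n) x)) \<le> M ^ n * norm x"
proof -
  let ?G = "{(x, y). d x - y \<in> jacobson_radical sm}"
  have "subspace ?G"
    unfolding subspace_def
    by (auto simp: radical_iff zero_prod_def d_zero d_add d_scaleR character_zero character_diff
        character_add character_scaleR)
  moreover have "\<exists>y. (x, y) \<in> ?G" for x
    by (rule exI[of _ "d x"]) (simp add: radical_iff character_zero)
  ultimately obtain M where M: "M \<ge> 0" "\<And>x. \<exists>y. (x, y) \<in> ?G \<and> norm y \<le> M * norm x"
    using closed_linear_relation_bounded[OF _ derivation_closed_mod_radical] by metis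
  have it: "\<exists>y. (d ^^ n) x - y \<in> jacobson_radical sm \<and> norm y \<le> M ^ n * norm x" for n x
  proof (induction n)
    case 0
    show ?case by (rule exI[of _ x]) (simp add: radical_iff character_zero)
  next
    case (Suc n)
    then obtain y where y: "(d ^^ n) x - y \<in> jacobson_radical sm" "norm y \<le> M ^ n * norm x" by blast
    obtain z where z: "d y - z \<in> jacobson_radical sm" "norm z \<le> M * norm y" using M(2)[of y] by auto
    have "(d ^^ Suc n) x - z = d ((d ^^ n) x - y) + (d y - z)" by (simp add: d_diff)
    then have "(d ^^ Suc n) x - z \<in> jacobson_radical sm"
      using d_radical[OF y(1)] z(1) unfolding radical_iff by (metis character_add add_0)
    moreover have "norm z \<le> M ^ Suc n * norm x"
      using z(2) mult_left_mono[OF y(2) M(1)] by simp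
    ultimately show ?case by blast
  qed
  have "norm (\<phi> ((d ^^ n) x)) \<le> M ^ n * norm x" if \<phi>: "character \<phi>" for \<phi> n x
  proof -
    obtain y where y: "(d ^^ n) x - y \<in> jacobson_radical sm" "norm y \<le> M ^ n * norm x" using it by blast
    then have "\<phi> ((d ^^ n) x) = \<phi> y" using \<phi> by (simp add: radical_iff character_diff)
    then show ?thesis using character_norm_le[OF \<phi>, of y] y by simp
  qed
  then show ?thesis using that M(1) by blast
qed

section \<open>Formal Taylor series and the vanishing of the derivation\<close>

text \<open>The formal version of \<open>t \<mapsto> \<phi> (exp (t d) a)\<close>.\<close>

definition taylor :: "('a \<Rightarrow> complex) \<Rightarrow> 'a \<Rightarrow> complex fps" where
  "taylor \<phi> a = Abs_fps (\<lambda>n. \<phi> ((d ^^ n) a) / fact n)"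

lemma taylor_derivative: "fps_deriv (taylor \<phi> a) = taylor \<phi> (d a)"
  by (rule fps_ext) (simp add: taylor_def funpow_swap1 field_simps del: of_nat_Suc)

text \<open>The exponential of a derivation is multiplicative. Comparing coefficients after
  differentiating replaces the binomial form of the Leibniz rule.\<close>

lemma taylor_mult:
  assumes \<phi>: "character \<phi>"
  shows "taylor \<phi> (a * b) = taylor \<phi> a * taylor \<phi> b"
proof (rule fps_ext)
  fix n
  show "fps_nth (taylor \<phi> (a * b)) n = fps_nth (taylor \<phi> a * taylor \<phi> b) n"
  proof (induction n arbitrary: a b)
    case 0
    show ?case by (simp add: taylor_def character_mult[OF \<phi>])
  next
    case (Suc n)
    have it_add: "(d ^^ k) (x + y) = (d ^^ k) x + (d ^^ k) y" for k x y
      by (induction k) (simp_all add: d_add)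
    have add: "taylor \<phi> (x + y) = taylor \<phi> x + taylor \<phi> y" for x y
      by (rule fps_ext) (simp add: taylor_def it_add character_add[OF \<phi>] add_divide_distrib)
    have "fps_nth (fps_deriv (taylor \<phi> (a * b))) n = fps_nth (fps_deriv (taylor \<phi> a * taylor \<phi> b)) n"
      by (simp add: taylor_derivative d_mult add Suc add.commute)
    then show ?case by (simp del: of_nat_Suc fps_deriv_mult)
  qed
qed

text \<open>As \<open>\<phi> x = 0\<close>, the series of \<open>x\<close> is
  \<open>fps_X * h\<close> with constant term \<open>\<phi> (d x)\<close> in \<open>h\<close>. The
  lowest coefficient of its powers gives the factorial growth that contradicts the bound
  \<open>M ^ n\<close>.\<close>

lemma character_derivation_zero_on_kernel:
  assumes \<phi>: "character \<phi>" and x: "\<phi> x = 0"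
  shows "\<phi> (d x) = 0"
proof (rule ccontr)
  assume nz: "\<phi> (d x) \<noteq> 0"
  obtain M where M: "M \<ge> 0" "\<And>\<phi> n x. character \<phi> \<Longrightarrow> norm (\<phi> ((d ^^ n) x)) \<le> M ^ n * norm x"
    by (rule iterated_derivation_bounded_mod_radical) blast
  \<comment> \<open>\<open>p n\<close> is the power of \<open>x\<close> with exponent
    \<open>n + 1\<close>, hence the \<open>Suc n\<close> below.\<close>
  define p where "p = (\<lambda>n. ((*) x ^^ n) x)"
  have tp: "taylor \<phi> (p n) = taylor \<phi> x ^ Suc n" for n
    by (induction n) (simp_all add: p_def taylor_mult[OF \<phi>])
  have np: "norm (p n) \<le> norm x ^ Suc n" for n
  proof (induction n)
    case (Suc n)
    have "norm (p (Suc n)) \<le> norm x * norm (p n)" by (simp add: p_def norm_mult_ineq)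
    also have "\<dots> \<le> norm x * norm x ^ Suc n" by (intro mult_left_mono Suc) auto
    finally show ?case by simp
  qed (simp add: p_def)
  have t0: "fps_nth (taylor \<phi> x) 0 = 0" and t1: "fps_nth (taylor \<phi> x) 1 = \<phi> (d x)" by (simp_all add: taylor_def x)
  obtain h where h: "taylor \<phi> x = fps_X * h" "fps_nth h 0 = \<phi> (d x)"
  proof
    show "taylor \<phi> x = fps_X * fps_shift 1 (taylor \<phi> x)"
      using t0 by (intro fps_ext) (auto simp: fps_X_mult_nth)
    show "fps_nth (fps_shift 1 (taylor \<phi> x)) 0 = \<phi> (d x)" using t1 by simp
  qed
  have coeff: "\<phi> ((d ^^ Suc n) (p n)) = fact (Suc n) * \<phi> (d x) ^ Suc n" for n
  proof -
    have "fps_nth (taylor \<phi> (p n)) (Suc n) = fps_nth (fps_X ^ Suc n * h ^ Suc n) (Suc n)"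
      by (simp only: tp h power_mult_distrib)
    also have "\<dots> = \<phi> (d x) ^ Suc n"
      by (simp only: fps_X_power_mult_nth fps_power_zeroth_eq_one) (simp add: h fps_nth_power_0)
    finally show ?thesis by (simp add: taylor_def field_simps del: funpow.simps of_nat_Suc fact_Suc)
  qed
  define D where "D = norm (\<phi> (d x))"
  have D: "D > 0" using nz by (simp add: D_def)
  have bound: "1 \<le> (M * norm x / D) ^ Suc n / fact (Suc n)" for n
  proof -
    have "fact (Suc n) * D ^ Suc n = norm (\<phi> ((d ^^ Suc n) (p n)))"
      unfolding coeff D_def by (simp add: norm_mult norm_power del: fact_Suc of_nat_Suc)
    also have "\<dots> \<le> M ^ Suc n * norm (p n)" by (rule M(2)[OF \<phi>])
    also have "\<dots> \<le> M ^ Suc n * norm x ^ Suc n" by (intro mult_left_mono np) (simp add: M(1))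
    finally have "fact (Suc n) * D ^ Suc n \<le> (M * norm x) ^ Suc n" by (simp only: power_mult_distrib)
    then show ?thesis using D by (simp add: power_divide field_simps del: power_Suc fact_Suc of_nat_Suc)
  qed
  \<comment> \<open>Terms of a convergent exponential series tend to 0, whereas \<open>bound\<close>
    keeps them at least 1.\<close>
  have "(\<lambda>n. (M * norm x / D) ^ n / fact n) \<longlonglongrightarrow> 0"
    using summable_LIMSEQ_zero[OF summable_exp[of "M * norm x / D"]] by (simp add: field_simps)
  then have "(\<lambda>n. (M * norm x / D) ^ Suc n / fact (Suc n)) \<longlonglongrightarrow> 0" by (rule LIMSEQ_Suc)
  from LIMSEQ_le_const[OF this, of 1] bound show False by auto
qed

text \<open>Since \<open>y - sm (\<phi> y) u\<close> lies in the kernel of \<open>\<phi>\<close>,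
  \<open>\<phi> \<circ> d\<close> is \<open>\<phi> (d u)\<close> times \<open>\<phi>\<close>. Taking
  \<open>y = u * u\<close> gives \<open>2 * \<phi> (d u) = \<phi> (d u)\<close>.\<close>

lemma derivation_range_subset_radical: "d x \<in> jacobson_radical sm"
  unfolding radical_iff
proof (intro allI impI)
  fix \<phi> assume \<phi>: "character \<phi>"
  obtain u where u: "\<phi> u = 1" using character_unit[OF \<phi>] by blast
  have eq: "\<phi> (d y) = \<phi> y * \<phi> (d u)" for y
  proof -
    have "\<phi> (d (y - sm (\<phi> y) u)) = 0"
      by (rule character_derivation_zero_on_kernel[OF \<phi>]) (simp add: character_diff[OF \<phi>] character_sm[OF \<phi>] u)
    then show ?thesis by (simp add: d_diff d_sm character_diff[OF \<phi>] character_sm[OF \<phi>])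
  qed
  have "\<phi> (d u) = 0"
    using eq[of "u * u"] by (simp add: character_d_mult[OF \<phi>] character_mult[OF \<phi>] u)
  then show "\<phi> (d x) = 0" using eq[of x] by simp
qed

end

theorem theorem3p2:
  fixes sm :: "complex \<Rightarrow> 'a::{real_normed_algebra,banach} \<Rightarrow> 'a"
    and d :: "'a \<Rightarrow> 'a"
  assumes "complex_banach_algebra sm"
    and "jacobson_radical sm = right_annihilator"
    and "\<forall>a b. a * b - b * a \<in> jacobson_radical sm"
    and "derivation sm d"
  shows "range d \<subseteq> jacobson_radical sm"
proof -
  interpret radical_derivation sm d
    using assms by unfold_locales auto
  show ?thesis using derivation_range_subset_radical by blast
qed

end
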